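(* Let $n$ be given. Then, for any positive constant $z<\frac{1}{n(n-1)}$, any algorithm that decides whether a connected allocation exists for $n$ hungry agents in which each agent receives a piece with value more than $1/n+z$ requires $\Omega(n\cdot 2^n)$ queries.
   Context: The cake is $C=[0,1]$, to be divided among agents $[n]$. Each agent $i$ has a valuation function $V_i$ on the algebra generated by intervals of $C$ that is non-negative, finitely additive, normalized ($V_i(C)=1$), with $x\mapsto V_i([0,x])$ continuous. Agent $i$ is hungry if $V_i(X)>0$ for every interval $X$ of positive length. An allocation is a partition $C=X_1\sqcup\cdots\sqcup X_n$ into finite unions of closed intervals, pairwise disjoint except possibly at endpoints, with $X_i$ given to agent $i$; it is connected if each $X_i$ is a single interval. Algorithms access valuations only via queries (each counts as one): $\textsc{Eval}_i(x,y)=V_i([x,y])$; $\textsc{Mark}_i(x,r)$ returns the largest $z\in C$ with $V_i([x,z])=r$, or $\infty$ if $V_i([x,1])<r$. *)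

theory Defs
  imports "HOL-Analysis.Analysis"
begin

abbreviation cake :: "real set" where
  "cake \<equiv> {0..1}"

definition cake_algebra :: "real set set" where
  "cake_algebra = algebra cake hull {X. X \<subseteq> cake \<and> is_interval X}"

text \<open>
  Continuity of \<open>x \<mapsto> V [0,x]\<close> on the cake makes every point other than 0 worthless, but does not
  exclude an atom at 0. It is excluded explicitly: otherwise the largest \<open>z\<close> with
  \<open>V [0,z] = r\<close> would not exist for small \<open>r\<close> and the mark query would be ill-defined.
\<close>
definition valuation :: "(real set \<Rightarrow> real) \<Rightarrow> bool" where
  "valuation V \<longleftrightarrow>
     (\<forall>X\<in>cake_algebra. 0 \<le> V X) \<and>
     Measure_Space.additive cake_algebra V \<and>
     V cake = 1 \<and>
     continuous_on cake (\<lambda>x. V {0..x}) \<and> V {0} = 0"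

definition hungry :: "(real set \<Rightarrow> real) \<Rightarrow> bool" where
  "hungry V \<longleftrightarrow> (\<forall>X. X \<subseteq> cake \<and> is_interval X \<and> measure lborel X > 0 \<longrightarrow> V X > 0)"

text \<open>The agents are \<open>1, \<dots>, n\<close>; the values of a profile at other indices are irrelevant.\<close>
type_synonym profile = "nat \<Rightarrow> real set \<Rightarrow> real"

definition hungry_profile :: "nat \<Rightarrow> profile \<Rightarrow> bool" where
  "hungry_profile n V \<longleftrightarrow> (\<forall>i\<in>{1..n}. valuation (V i) \<and> hungry (V i))"

text \<open>The endpoints of a finite union of closed intervals are its frontier points.\<close>
definition allocation :: "nat \<Rightarrow> (nat \<Rightarrow> real set) \<Rightarrow> bool" where
  "allocation n X \<longleftrightarrow>
     (\<forall>i\<in>{1..n}. \<exists>\<I>. finite \<I> \<and> (\<forall>J\<in>\<I>. \<exists>a b. a \<le> b \<and> J = {a..b}) \<and> X i = \<Union>\<I>) \<and>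
     (\<Union>i\<in>{1..n}. X i) = cake \<and>
     (\<forall>i\<in>{1..n}. \<forall>j\<in>{1..n}. i \<noteq> j \<longrightarrow> X i \<inter> X j \<subseteq> frontier (X i) \<inter> frontier (X j))"

definition connected_allocation :: "nat \<Rightarrow> (nat \<Rightarrow> real set) \<Rightarrow> bool" where
  "connected_allocation n X \<longleftrightarrow>
     allocation n X \<and> (\<forall>i\<in>{1..n}. \<exists>a b. a \<le> b \<and> X i = {a..b})"

definition exists_good_allocation :: "nat \<Rightarrow> real \<Rightarrow> profile \<Rightarrow> bool" where
  "exists_good_allocation n z V \<longleftrightarrow>
     (\<exists>X. connected_allocation n X \<and> (\<forall>i\<in>{1..n}. V i (X i) > 1 / real n + z))"

datatype query = Eval nat real real | Mark nat real real

fun legal_query :: "nat \<Rightarrow> query \<Rightarrow> bool" where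
  "legal_query n (Eval i x y) \<longleftrightarrow> i \<in> {1..n} \<and> 0 \<le> x \<and> x \<le> y \<and> y \<le> 1"
| "legal_query n (Mark i x r) \<longleftrightarrow> i \<in> {1..n} \<and> 0 \<le> x \<and> x \<le> 1 \<and> 0 \<le> r"

fun reply :: "profile \<Rightarrow> query \<Rightarrow> ereal" where
  "reply V (Eval i x y) = ereal (V i {x..y})"
| "reply V (Mark i x r) =
     (if V i {x..1} < r then \<infinity> else ereal (GREATEST z. z \<in> cake \<and> V i {x..z} = r))"

datatype action = Ask query | Answer bool

text \<open>
  A deterministic adaptive algorithm: the next action is an arbitrary function of the replies
  received so far (which determine the queries asked so far).
\<close>
type_synonym algorithm = "ereal list \<Rightarrow> action"

inductive reaches :: "algorithm \<Rightarrow> profile \<Rightarrow> ereal list \<Rightarrow> bool" for A V where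
  start: "reaches A V []"
| step: "reaches A V h \<Longrightarrow> A h = Ask q \<Longrightarrow> reaches A V (h @ [reply V q])"

text \<open>On \<open>V\<close>, the algorithm halts with answer \<open>b\<close> after exactly \<open>k\<close> queries.\<close>
definition halts :: "algorithm \<Rightarrow> profile \<Rightarrow> bool \<Rightarrow> nat \<Rightarrow> bool" where
  "halts A V b k \<longleftrightarrow> (\<exists>h. reaches A V h \<and> A h = Answer b \<and> length h = k)"

definition decides_good_allocation :: "nat \<Rightarrow> real \<Rightarrow> algorithm \<Rightarrow> bool" where
  "decides_good_allocation n z A \<longleftrightarrow>
     (\<forall>V. hungry_profile n V \<longrightarrow>
        (\<forall>h q. reaches A V h \<and> A h = Ask q \<longrightarrow> legal_query n q) \<and>
        (\<exists>k. halts A V (exists_good_allocation n z V) k))"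

end

theory Submission
  imports Defs "HOL-Library.Nat_Bijection"
begin

text \<open>
  Write \<open>w = 1/n + z\<close>, so that \<open>(n - 1) w < 1 < n w\<close>. To each set \<open>S\<close> of agents below \<open>n\<close> belongs a
  point \<open>p S = |S| w + e (\<Sum>j\<in>S. 2^j)\<close> of the cake, for a tiny \<open>e\<close>. The base profile is chosen such
  that agent \<open>j < n\<close> values \<open>[p S, p (S \<union> {j})]\<close> at exactly \<open>w\<close> for every \<open>S\<close> not containing \<open>j\<close>, while
  agent \<open>n\<close> values the part of the cake right of \<open>p {1..<n}\<close> at exactly \<open>w\<close>. Hence agents served from
  left to right with more than \<open>w\<close> each always end up right of \<open>p S\<close>, and no good allocation
  exists; but every order with agent \<open>n\<close> last is tight. Adding a tiny tent at \<open>p T\<close> to the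
  distribution function of some \<open>j \<in> T\<close> lets \<open>j\<close> stop slightly early in an order that serves
  \<open>T - {j}\<close>, then \<open>j\<close>, then the rest, and this gain can be shared among all agents. There are
  \<open>(n - 1) 2^(n-2)\<close> such tents, and a query reads the distribution function of one agent at only
  two points, so it can rule out at most two of them.
\<close>

section \<open>Valuations given by distribution functions\<close>

text \<open>\<open>interval_measure\<close> takes a function on the whole line, hence conditions
  beyond the cake. Strictness makes agents hungry and marks unique.\<close>

definition cdf :: "(real \<Rightarrow> real) \<Rightarrow> bool" where
  "cdf F \<longleftrightarrow> strict_mono F \<and> continuous_on UNIV F \<and> F 0 = 0 \<and> F 1 = 1"

definition val :: "(real \<Rightarrow> real) \<Rightarrow> real set \<Rightarrow> real" where
  "val F = measure (interval_measure F)"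

lemma cdf_less: "cdf F \<Longrightarrow> F x < F y \<longleftrightarrow> x < y"
  by (simp add: cdf_def strict_mono_less)

lemma cdf_le: "cdf F \<Longrightarrow> F x \<le> F y \<longleftrightarrow> x \<le> y"
  by (simp add: cdf_def strict_mono_less_eq)

lemma emeasure_cdf:
  assumes "cdf F" "x \<le> y"
  shows "emeasure (interval_measure F) {x..y} = ennreal (F y - F x)"
  using assms by (intro emeasure_interval_measure_Icc) (auto simp: cdf_le cdf_def)

lemma val_Icc:
  assumes "cdf F" "x \<le> y"
  shows "val F {x..y} = F y - F x"
  using emeasure_cdf[OF assms] assms by (simp add: val_def measure_def cdf_le)

text \<open>The Borel subsets of the cake form an algebra containing its intervals, so the hull lies
  inside it.\<close>

lemma cake_algebra_borel:
  assumes "X \<in> cake_algebra"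
  shows "X \<subseteq> cake \<and> X \<in> sets borel"
proof -
  have "algebra cake {X. X \<subseteq> cake \<and> X \<in> sets borel}"
    by (auto simp: algebra_iff_Un)
  moreover have "X \<in> sets borel" if "is_interval X" for X :: "real set"
    using that by (rule real_interval_borel_measurable)
  ultimately have "cake_algebra \<subseteq> {X. X \<subseteq> cake \<and> X \<in> sets borel}"
    unfolding cake_algebra_def by (intro hull_minimal) auto
  with assms show ?thesis by auto
qed

lemma emeasure_cdf_finite:
  assumes "cdf F" "X \<subseteq> cake"
  shows "emeasure (interval_measure F) X < \<infinity>"
proof -
  have "emeasure (interval_measure F) X \<le> emeasure (interval_measure F) {0..1}"
    using assms by (intro emeasure_mono) auto
  also have "\<dots> < \<infinity>"
    using assms by (simp add: emeasure_cdf)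
  finally show ?thesis .
qed

lemma valuation_val:
  assumes F: "cdf F"
  shows "valuation (val F)"
proof -
  have "Measure_Space.additive cake_algebra (val F)"
    unfolding Measure_Space.additive_def val_def
  proof (intro ballI impI)
    fix X Y assume XY: "X \<in> cake_algebra" "Y \<in> cake_algebra" "X \<inter> Y = {}"
    show "measure (interval_measure F) (X \<union> Y) =
          measure (interval_measure F) X + measure (interval_measure F) Y"
      using XY cake_algebra_borel[OF XY(1)] cake_algebra_borel[OF XY(2)]
        emeasure_cdf_finite[OF F, of X] emeasure_cdf_finite[OF F, of Y]
      by (intro measure_Union) auto
  qed
  moreover have "continuous_on cake (\<lambda>x. val F {0..x})"
  proof -
    have "continuous_on cake F"
      using F continuous_on_subset unfolding cdf_def by blast
    then show ?thesis
      using F by (subst continuous_on_cong[where g = F]) (auto simp: val_Icc, simp add: cdf_def)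
  qed
  moreover have "val F {0} = 0"
    using val_Icc[OF F, of 0 0] by simp
  ultimately show ?thesis
    using F val_Icc[OF F, of 0 1] unfolding valuation_def cdf_def by (simp add: val_def)
qed

lemma hungry_val:
  assumes F: "cdf F"
  shows "hungry (val F)"
  unfolding hungry_def
proof (intro allI impI, elim conjE)
  fix X :: "real set"
  assume X: "X \<subseteq> cake" "is_interval X" "0 < measure lborel X"
  have "\<exists>a\<in>X. \<exists>b\<in>X. a < b"
  proof (rule ccontr)
    assume "\<not> ?thesis"
    then have "X \<subseteq> {a}" if "a \<in> X" for a
      using that by (auto simp: not_less intro: antisym)
    then have "X = {} \<or> (\<exists>a. X = {a})" by blast
    with X(3) show False by (auto simp: measure_def)
  qed
  then obtain a b where ab: "a \<in> X" "b \<in> X" "a < b" by blast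
  have sub: "{a..b} \<subseteq> X"
    using mem_is_interval_1_I[OF X(2) ab(1,2)] by auto
  have XB: "X \<in> sets (interval_measure F)"
    using X(2) by (simp add: real_interval_borel_measurable)
  have "0 < F b - F a"
    using F ab by (simp add: cdf_less)
  also have "\<dots> = val F {a..b}"
    using F ab by (simp add: val_Icc)
  also have "\<dots> \<le> val F X"
    unfolding val_def using sub XB emeasure_cdf_finite[OF F X(1)]
    by (intro measure_mono_fmeasurable fmeasurableI) auto
  finally show "0 < val F X" .
qed

text \<open>By strict monotonicity \<open>y\<close> is the only candidate at or right of
  \<open>x\<close>; a candidate left of \<open>x\<close> comes from an empty interval and is below
  \<open>y\<close> anyway.\<close>

lemma Mark_reply:
  assumes F: "cdf (f i)" and x: "0 \<le> x" "x \<le> y" "y \<le> 1"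
  shows "reply (\<lambda>i. val (f i)) (Mark i x (f i y - f i x)) = ereal y"
proof -
  have "(GREATEST z. z \<in> cake \<and> val (f i) {x..z} = f i y - f i x) = y"
  proof (rule Greatest_equality)
    show "y \<in> cake \<and> val (f i) {x..y} = f i y - f i x"
      using F x by (simp add: val_Icc)
    fix z assume z: "z \<in> cake \<and> val (f i) {x..z} = f i y - f i x"
    show "z \<le> y"
    proof (cases "x \<le> z")
      case True
      then have "f i z = f i y" using z F by (simp add: val_Icc)
      then show ?thesis using cdf_le[OF F, of z y] by simp
    qed (use x in auto)
  qed
  moreover have "\<not> val (f i) {x..1} < f i y - f i x"
    using F x by (simp add: val_Icc cdf_less not_less cdf_le)
  ultimately show ?thesis by simp
qed

lemma Mark_reply_infinite:
  assumes "cdf (f i)" "x \<le> 1" "f i 1 - f i x < r"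
  shows "reply (\<lambda>i. val (f i)) (Mark i x r) = \<infinity>"
  using assms by (simp add: val_Icc)

text \<open>The points at which answering a query reads the distribution function of the agent. For an
  infinite reply the second point is the junk value 0, which does no harm.\<close>
fun touched :: "profile \<Rightarrow> query \<Rightarrow> (nat \<times> real) set" where
  "touched V (Eval i x y) = {(i, x), (i, y)}"
| "touched V (Mark i x r) = {(i, x), (i, real_of_ereal (reply V (Mark i x r)))}"

lemma touched_card: "finite (touched V q)" "card (touched V q) \<le> 2"
  by (cases q; simp add: card_insert_if)+

text \<open>A finite mark \<open>y\<close> is characterised by \<open>f i y - f i x = r\<close>,
  which involves two points only. Whether the mark is infinite depends, given \<open>r\<close>, on
  the value at \<open>x\<close>, as both functions are 1 at 1.\<close>

lemma reply_eq_if_untouched: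
  assumes f: "\<And>i. i \<in> {1..n} \<Longrightarrow> cdf (f i)" and g: "\<And>i. i \<in> {1..n} \<Longrightarrow> cdf (g i)"
    and q: "legal_query n q"
    and eq: "\<And>i x. (i, x) \<in> touched (\<lambda>i. val (f i)) q \<Longrightarrow> g i x = f i x"
  shows "reply (\<lambda>i. val (g i)) q = reply (\<lambda>i. val (f i)) q"
proof (cases q)
  case (Eval i x y)
  then show ?thesis using f g q eq by (simp add: val_Icc)
next
  case (Mark i x r)
  then have i: "i \<in> {1..n}" and x: "0 \<le> x" "x \<le> 1" "0 \<le> r" using q by auto
  have gx: "g i x = f i x" using eq Mark by simp
  have one: "f i 1 = 1" "g i 1 = 1" using f[OF i] g[OF i] by (auto simp: cdf_def)
  show ?thesis
  proof (cases "f i 1 - f i x < r")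
    case True
    then show ?thesis
      unfolding Mark using Mark_reply_infinite[of f, OF f[OF i]] Mark_reply_infinite[of g, OF g[OF i]]
        x gx one by metis
  next
    case False
    have "\<exists>y\<ge>x. y \<le> 1 \<and> f i y = f i x + r"
      using False x f[OF i] by (intro IVT') (auto simp: cdf_def intro: continuous_on_subset)
    then obtain y where y: "x \<le> y" "y \<le> 1" "f i y = f i x + r" by blast
    have r: "reply (\<lambda>i. val (f i)) (Mark i x r) = ereal y"
      using Mark_reply[of f i, OF f[OF i] x(1) y(1,2)] y(3) by simp
    have "g i y = f i y"
      using eq[of i y] r unfolding Mark by (simp del: reply.simps)
    then show ?thesis
      using Mark_reply[of g i, OF g[OF i] x(1) y(1,2)] y(3) gx r unfolding Mark by simp
  qed
qed

section \<open>Runs of an algorithm\<close>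

lemma reaches_prefix:
  assumes "reaches A V h" "m < length h"
  shows "\<exists>q. reaches A V (take m h) \<and> A (take m h) = Ask q \<and> h ! m = reply V q"
  using assms
proof (induction rule: reaches.induct)
  case (step h q)
  then show ?case
    by (cases "m = length h") (auto simp: nth_append)
qed simp

lemma reaches_transfer:
  assumes "reaches A V h"
    and "\<And>m q. m < length h \<Longrightarrow> A (take m h) = Ask q \<Longrightarrow> reply W q = reply V q"
  shows "reaches A W h"
  using assms
proof (induction rule: reaches.induct)
  case (step h q)
  have "reaches A W h"
  proof (rule step.IH)
    fix m q' assume "m < length h" "A (take m h) = Ask q'"
    then show "reply W q' = reply V q'" using step.prems[of m q'] by simp
  qed
  moreover have "reply W q = reply V q" using step.prems[of "length h" q] step.hyps by simp
  ultimately show ?case using reaches.step[of A W h q] step.hyps by simp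
qed (rule reaches.start)

lemma reaches_take_unique:
  assumes "reaches A V h" "reaches A V h'" "length h \<le> length h'"
  shows "h = take (length h) h'"
  using assms
proof (induction rule: reaches.induct)
  case (step h q)
  then have h: "h = take (length h) h'" and l: "length h < length h'" by auto
  from reaches_prefix[OF step.prems(1) l] h step.hyps
  have "h' ! length h = reply V q" by auto
  then show ?case using h l by (simp add: take_Suc_conv_app_nth)
qed simp

text \<open>Of two runs on one profile the shorter is a prefix of the longer, and a run that has
  answered is not continued.\<close>

lemma answer_unique:
  assumes "reaches A V h" "A h = Answer b" "reaches A V h'" "A h' = Answer b'"
  shows "b = b'"
proof -
  have *: "b = b'" if "reaches A V h" "A h = Answer b" "reaches A V h'" "A h' = Answer b'"
    "length h \<le> length h'" for h h' b b'
  proof -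
    have h: "h = take (length h) h'" using that reaches_take_unique by blast
    have "\<not> length h < length h'"
      using reaches_prefix[OF that(3), of "length h"] that(2) h by auto
    with h that show ?thesis by auto
  qed
  show ?thesis
    using *[of h b h' b'] *[of h' b' h b] assms by (cases "length h \<le> length h'") auto
qed

lemma card_touched_history:
  assumes "reaches A V h"
  obtains U where "finite U" "card U \<le> 2 * length h"
    "\<And>m q. m < length h \<Longrightarrow> A (take m h) = Ask q \<Longrightarrow> touched V q \<subseteq> U"
proof -
  have "\<forall>m\<in>{..<length h}. \<exists>q. A (take m h) = Ask q"
    using reaches_prefix[OF assms] by blast
  then obtain Q where Q: "\<forall>m\<in>{..<length h}. A (take m h) = Ask (Q m)"
    by (rule bchoice[THEN exE])
  let ?U = "\<Union>m<length h. touched V (Q m)"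
  have "card ?U \<le> (\<Sum>m<length h. card (touched V (Q m)))"
    by (intro card_UN_le) simp
  also have "\<dots> \<le> (\<Sum>m<length h. 2)"
    by (intro sum_mono touched_card)
  finally have "card ?U \<le> 2 * length h" by simp
  moreover have "finite ?U" by (auto simp: touched_card)
  ultimately show thesis using Q by (intro that[of ?U]) auto
qed

section \<open>Connected allocations\<close>

text \<open>Intervals are taken from left to right; the hypothesis says that \<open>\<phi>\<close> of the set of intervals
  already passed remains a lower bound for the current position.\<close>
lemma chain_bound:
  fixes a b :: "'i \<Rightarrow> real" and \<phi> :: "'i set \<Rightarrow> real"
  assumes "finite I"
    and "\<And>i. i \<in> I \<Longrightarrow> a i < b i \<and> L \<le> a i \<and> b i \<le> R" "L \<le> R"
    and "\<And>i j. i \<in> I \<Longrightarrow> j \<in> I \<Longrightarrow> i \<noteq> j \<Longrightarrow> b i \<le> a j \<or> b j \<le> a i"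
    and "\<phi> {} \<le> L"
    and "\<And>S m. S \<subseteq> I \<Longrightarrow> m \<in> I - S \<Longrightarrow> \<phi> S \<le> a m \<Longrightarrow> \<phi> (insert m S) \<le> b m"
  shows "\<phi> I \<le> R"
  using assms
proof (induction "card I" arbitrary: I R)
  case 0
  then show ?case by auto
next
  case (Suc k)
  then have "I \<noteq> {}" by auto
  \<comment> \<open>The interval with the largest left endpoint lies right of all others, so the
    induction hypothesis applies to these with \<open>R = a m\<close>.\<close>
  then have "Max (a ` I) \<in> a ` I" using \<open>finite I\<close> by simp
  then obtain m where "m \<in> I" "a m = Max (a ` I)" by force
  then have m: "m \<in> I" "\<And>i. i \<in> I \<Longrightarrow> a i \<le> a m"
    using \<open>finite I\<close> by auto
  have before: "b i \<le> a m" if "i \<in> I - {m}" for i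
  proof -
    have "a i < b i" "a m < b m" "a i \<le> a m" "b i \<le> a m \<or> b m \<le> a i"
      using Suc.prems(2)[of m] Suc.prems(2)[of i] Suc.prems(4)[of i m] m(2)[of i] m(1) that
      by auto
    then show ?thesis by linarith
  qed
  have "\<phi> (I - {m}) \<le> a m"
  proof (rule Suc.hyps(1))
    show "k = card (I - {m})" using Suc.hyps(2) m Suc.prems(1) by simp
    show "\<phi> (insert i S) \<le> b i"
      if "S \<subseteq> I - {m}" "i \<in> I - {m} - S" "\<phi> S \<le> a i" for S i
      using that Suc.prems(6)[of S i] by blast
  qed (use Suc.prems m before in auto)
  then have "\<phi> (insert m (I - {m})) \<le> b m"
    using Suc.prems(6)[of "I - {m}" m] m by auto
  then show ?case using m Suc.prems(2)[of m] by (simp add: insert_absorb)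
qed

lemma good_allocation_from_cuts:
  fixes c :: "nat \<Rightarrow> real"
  assumes xs: "distinct xs" "set xs = {1..n}" and c: "c 0 = 0" "c n = 1"
    and inc: "\<And>k. k < n \<Longrightarrow> c k < c (Suc k)"
    and good: "\<And>k. k < n \<Longrightarrow> V (xs ! k) {c k..c (Suc k)} > 1 / real n + z"
  shows "exists_good_allocation n z V"
proof -
  have len: "length xs = n" using xs distinct_card[of xs] by simp
  have mono: "c k \<le> c l" if "k \<le> l" "l \<le> n" for k l
    using that
  proof (induction l rule: dec_induct)
    case (step l)
    then show ?case using inc[of l] by simp
  qed simp
  have "\<forall>i\<in>{1..n}. \<exists>k<n. xs ! k = i"
    using xs len by (metis in_set_conv_nth)
  then obtain pos where pos: "\<And>i. i \<in> {1..n} \<Longrightarrow> pos i < n \<and> xs ! pos i = i"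
    by metis
  have pos_nth: "xs ! k \<in> {1..n} \<and> pos (xs ! k) = k" if "k < n" for k
  proof -
    have "xs ! k \<in> {1..n}" using that len xs by (metis nth_mem)
    then show ?thesis
      using pos[of "xs ! k"] that len xs(1) nth_eq_iff_index_eq[of xs "pos (xs ! k)" k] by simp
  qed
  define X where "X i = {c (pos i)..c (Suc (pos i))}" for i
  have X_le: "c (pos i) < c (Suc (pos i))" if "i \<in> {1..n}" for i
    using inc pos that by blast
  have fr: "frontier (X i) = X i - {c (pos i)<..<c (Suc (pos i))}" for i
    by (simp add: X_def frontier_def)
  have meet: "X i \<inter> X j \<subseteq> frontier (X i) \<inter> frontier (X j)"
    if ij: "i \<in> {1..n}" "j \<in> {1..n}" "i \<noteq> j" for i j
  proof -
    have "pos i \<noteq> pos j" using pos ij by metis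
    then consider "Suc (pos i) \<le> pos j" | "Suc (pos j) \<le> pos i" by linarith
    then show ?thesis
    proof cases
      case 1
      then have "c (Suc (pos i)) \<le> c (pos j)" using mono pos[OF ij(2)] by simp
      then show ?thesis unfolding fr by (auto simp: X_def)
    next
      case 2
      then have "c (Suc (pos j)) \<le> c (pos i)" using mono pos[OF ij(1)] by simp
      then show ?thesis unfolding fr by (auto simp: X_def)
    qed
  qed
  have find: "\<exists>k<m. c k \<le> x \<and> x \<le> c (Suc k)" if "0 < m" "m \<le> n" "0 \<le> x" "x \<le> c m" for m x
    using that
  proof (induction m)
    case (Suc m)
    show ?case
    proof (cases "x \<le> c m \<and> 0 < m")
      case True
      then show ?thesis using Suc less_Suc_eq by auto
    next
      case False
      then show ?thesis using Suc.prems c(1) by (intro exI[of _ m]) auto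
    qed
  qed simp
  have n0: "0 < n" using c by (cases n) auto
  have cover: "(\<Union>i\<in>{1..n}. X i) = cake"
  proof (intro equalityI subsetI)
    fix x assume "x \<in> (\<Union>i\<in>{1..n}. X i)"
    then obtain i where i: "i \<in> {1..n}" "x \<in> X i" by blast
    have "0 \<le> c (pos i)" "c (Suc (pos i)) \<le> 1"
      using mono[of 0 "pos i"] mono[of "Suc (pos i)" n] pos[OF i(1)] c by auto
    then show "x \<in> cake" using i by (auto simp: X_def)
  next
    fix x assume "x \<in> cake"
    then obtain k where k: "k < n" "c k \<le> x" "x \<le> c (Suc k)"
      using find[of n x] n0 c by auto
    then show "x \<in> (\<Union>i\<in>{1..n}. X i)"
      using pos_nth[OF k(1)] by (intro UN_I[of "xs ! k"]) (auto simp: X_def)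
  qed
  have "\<exists>\<I>. finite \<I> \<and> (\<forall>J\<in>\<I>. \<exists>a b. a \<le> b \<and> J = {a..b}) \<and> X i = \<Union>\<I>"
    if "i \<in> {1..n}" for i
    using X_le[OF that] by (intro exI[of _ "{X i}"]) (auto simp: X_def less_imp_le)
  then have "allocation n X"
    unfolding allocation_def using meet cover by blast
  moreover have "\<exists>a b. a \<le> b \<and> X i = {a..b}" if "i \<in> {1..n}" for i
    using less_imp_le[OF X_le[OF that]] unfolding X_def by blast
  moreover have "V i (X i) > 1 / real n + z" if "i \<in> {1..n}" for i
    using good[of "pos i"] pos[OF that] by (simp add: X_def)
  ultimately show ?thesis
    unfolding exists_good_allocation_def connected_allocation_def by blast
qed

text \<open>A nonnegative threshold forces nondegenerate pieces, and two of these that overlap in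
  more than an endpoint share an interior point, which is not in the frontier.\<close>

lemma allocation_endpoints:
  fixes f :: "nat \<Rightarrow> real \<Rightarrow> real"
  assumes f: "\<And>i. i \<in> {1..n} \<Longrightarrow> cdf (f i)" and w: "0 \<le> 1 / real n + z"
    and good: "exists_good_allocation n z (\<lambda>i. val (f i))"
  obtains a b where
    "\<And>i. i \<in> {1..n} \<Longrightarrow> 0 \<le> a i \<and> a i < b i \<and> b i \<le> 1 \<and> f i (b i) - f i (a i) > 1 / real n + z"
    "\<And>i j. i \<in> {1..n} \<Longrightarrow> j \<in> {1..n} \<Longrightarrow> i \<noteq> j \<Longrightarrow> b i \<le> a j \<or> b j \<le> a i"
proof -
  obtain X where X: "allocation n X" "\<forall>i\<in>{1..n}. \<exists>a b. a \<le> b \<and> X i = {a..b}"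
    and v: "\<forall>i\<in>{1..n}. val (f i) (X i) > 1 / real n + z"
    using good unfolding exists_good_allocation_def connected_allocation_def by blast
  obtain a b where ab: "\<And>i. i \<in> {1..n} \<Longrightarrow> a i \<le> b i \<and> X i = {a i..b i}"
    using X(2) by metis
  have val: "f i (b i) - f i (a i) > 1 / real n + z" if "i \<in> {1..n}" for i
    using v ab[OF that] val_Icc[OF f[OF that]] that by metis
  have lt: "a i < b i" if "i \<in> {1..n}" for i
    using val[OF that] w cdf_less[OF f[OF that], of "a i" "b i"] by linarith
  have "X i \<subseteq> cake" if "i \<in> {1..n}" for i
    using X(1) that unfolding allocation_def by blast
  then have sub: "0 \<le> a i \<and> b i \<le> 1" if "i \<in> {1..n}" for i
    using ab[OF that] that by fastforce
  have "b i \<le> a j \<or> b j \<le> a i" if ij: "i \<in> {1..n}" "j \<in> {1..n}" "i \<noteq> j" for i j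
  proof (rule ccontr)
    assume no: "\<not> ?thesis"
    then have "max (a i) (a j) < min (b i) (b j)" using lt ij by auto
    then obtain x where x: "max (a i) (a j) < x" "x < min (b i) (b j)" using dense by blast
    then have "x \<in> X i \<inter> X j" using ab ij by auto
    then have "x \<in> frontier (X i)" using X(1) ij unfolding allocation_def by blast
    then show False using x ab[OF ij(1)] by (auto simp: frontier_def)
  qed
  moreover have "0 \<le> a i \<and> a i < b i \<and> b i \<le> 1 \<and> f i (b i) - f i (a i) > 1 / real n + z"
    if "i \<in> {1..n}" for i
    using val[OF that] lt[OF that] sub[OF that] by blast
  ultimately show thesis by (rule that[rotated])
qed

section \<open>The hard instances\<close>

definition clamp01 :: "real \<Rightarrow> real" where
  "clamp01 t = max 0 (min 1 t)"

lemma clamp01_bounds: "0 \<le> clamp01 t" "clamp01 t \<le> 1"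
  by (auto simp: clamp01_def)

lemma clamp01_diff_le: "s \<le> t \<Longrightarrow> clamp01 t - clamp01 s \<le> t - s"
  by (auto simp: clamp01_def max_def min_def)

lemma clamp01_mono: "s \<le> t \<Longrightarrow> clamp01 s \<le> clamp01 t"
  by (auto simp: clamp01_def max_def min_def)

text \<open>\<open>d\<close> is the length left over by \<open>n - 1\<close> pieces of length
  \<open>w\<close>; \<open>0 < d\<close> is the upper bound on \<open>z\<close>. The bounds on
  \<open>e\<close> keep all perturbations, of size at most \<open>e 2^n n\<close>, within a quarter
  of \<open>z\<close> and of \<open>d\<close>.\<close>

locale hard_instance =
  fixes n :: nat and z w d e :: real
  assumes n2: "2 \<le> n" and z0: "0 < z" and d0: "0 < d"
    and w_def: "w = 1 / real n + z" and d_def: "d = 1 - (real n - 1) * w"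
    and e0: "0 < e" and ez: "4 * (e * 2 ^ n * real n) \<le> z" and ed: "4 * (e * 2 ^ n * real n) \<le> d"
begin

lemma nw: "real n * w = 1 + real n * z"
  using n2 by (simp add: w_def field_simps)

lemma w_minus_d: "w - d = real n * z"
  using nw by (simp add: d_def algebra_simps)

lemma d_less_w: "d < w"
  using w_minus_d z0 n2 by (smt (verit) mult_pos_pos of_nat_0_less_iff zero_less_numeral order_less_le_trans)

lemma w_gt: "z < w" "0 < w"
  using z0 n2 by (simp_all add: w_def add_pos_pos)

lemma w_less_1: "w < 1"
proof -
  have "1 * w \<le> (real n - 1) * w"
    using n2 w_gt by (intro mult_right_mono) auto
  then show ?thesis using d0 by (simp add: d_def)
qed

lemma e_small: "8 * (e * 2 ^ n) \<le> z" "8 * (e * 2 ^ n) \<le> d" "e \<le> e * 2 ^ n"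
proof -
  have "e * 2 ^ n * 2 \<le> e * 2 ^ n * real n"
    using n2 e0 by (intro mult_left_mono) auto
  then show "8 * (e * 2 ^ n) \<le> z" "8 * (e * 2 ^ n) \<le> d" using ez ed by linarith+
  show "e \<le> e * 2 ^ n" using e0 by simp
qed

text \<open>A piecewise linear function that is equal to \<open>k\<close> slightly right of \<open>k w\<close> for each \<open>k < n\<close>, and
  returns to 0 at the right end of the cake.\<close>
definition plateau :: "real \<Rightarrow> real" where
  "plateau x = (\<Sum>k=1..<n. clamp01 (2 * x / w - (2 * real k - 1)))
           - (real n - 1) * clamp01 (2 * (x - 1) / d + 1)"

text \<open>Ramp \<open>l\<close> starts at \<open>(l - 1/2) w\<close> and is complete at
  \<open>l w\<close>. As \<open>d < w\<close>, the range of \<open>x\<close> lies beyond ramps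
  \<open>1, ..., k\<close> and before the later ones; the final descent starts only at
  \<open>1 - d/2\<close>.\<close>

lemma plateau_eq:
  assumes "k < n" "real k * w \<le> x" "x \<le> real k * w + d / 2"
  shows "plateau x = real k"
proof -
  have x: "2 * real k \<le> 2 * x / w" "2 * x / w \<le> 2 * real k + 1"
    using assms w_gt d_less_w by (auto simp: field_simps)
  have "clamp01 (2 * x / w - (2 * real l - 1)) = (if l \<le> k then 1 else 0)" for l
  proof (cases "l \<le> k")
    case True
    then have "real l \<le> real k" by simp
    with x True show ?thesis by (simp add: clamp01_def)
  next
    case False
    then have "real k + 1 \<le> real l" by simp
    with x False show ?thesis by (simp add: clamp01_def)
  qed
  then have "(\<Sum>l=1..<n. clamp01 (2 * x / w - (2 * real l - 1))) = (\<Sum>l=1..<n. if l \<le> k then 1 else 0)"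
    by simp
  also have "\<dots> = real (card {l \<in> {1..<n}. l \<le> k})"
    by (simp add: sum.If_cases Int_def)
  also have "{l \<in> {1..<n}. l \<le> k} = {1..k}" using assms(1) by auto
  finally have 1: "(\<Sum>l=1..<n. clamp01 (2 * x / w - (2 * real l - 1))) = real k" by simp
  have "real k * w \<le> (real n - 1) * w"
    using assms(1) w_gt by (intro mult_right_mono) auto
  then have "x \<le> 1 - d / 2" using assms(3) by (simp add: d_def field_simps)
  then have "2 * (x - 1) / d + 1 \<le> 0" using d0 by (simp add: field_simps)
  then have "clamp01 (2 * (x - 1) / d + 1) = 0" by (simp add: clamp01_def)
  with 1 show ?thesis by (simp add: plateau_def)
qed

lemma plateau_1: "plateau 1 = 0"
proof -
  have "clamp01 (2 * 1 / w - (2 * real l - 1)) = 1" if "l \<in> {1..<n}" for l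
  proof -
    have "real l * w \<le> (real n - 1) * w"
      using that w_gt by (intro mult_right_mono) auto
    then have "real l * w \<le> 1" using d0 by (simp add: d_def)
    then have "real l \<le> 1 / w" using w_gt by (simp add: field_simps)
    then show ?thesis by (simp add: clamp01_def)
  qed
  then have "(\<Sum>l=1..<n. clamp01 (2 * 1 / w - (2 * real l - 1))) = (\<Sum>l=1..<n. 1)"
    by (intro sum.cong) auto
  then show ?thesis using n2 by (simp add: plateau_def clamp01_def of_nat_diff)
qed

text \<open>Each of the \<open>n - 1\<close> ramps has slope at most \<open>2/w\<close>, and the
  descent only helps. \<open>F\<close> subtracts the plateau, so its monotonicity is threatened only
  by the rise.\<close>

lemma plateau_diff_le:
  assumes "x \<le> y"
  shows "plateau y - plateau x \<le> real n * (2 / w) * (y - x)"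
proof -
  let ?s = "\<lambda>x l. clamp01 (2 * x / w - (2 * real l - 1))"
  have ramp: "clamp01 (2 * (x - 1) / d + 1) \<le> clamp01 (2 * (y - 1) / d + 1)"
    using assms d0 by (intro clamp01_mono) (simp add: divide_right_mono)
  have "plateau y - plateau x \<le> (\<Sum>l=1..<n. ?s y l - ?s x l)"
    using mult_left_mono[OF ramp, of "real n - 1"] n2 by (simp add: plateau_def sum_subtractf)
  also have "\<dots> \<le> (\<Sum>l=1..<n. 2 / w * (y - x))"
  proof (intro sum_mono)
    fix l
    have "?s y l - ?s x l \<le> (2 * y / w - (2 * real l - 1)) - (2 * x / w - (2 * real l - 1))"
      using assms w_gt by (intro clamp01_diff_le) (simp add: divide_right_mono)
    also have "\<dots> = 2 / w * (y - x)" by (simp add: algebra_simps diff_divide_distrib)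
    finally show "?s y l - ?s x l \<le> 2 / w * (y - x)" .
  qed
  also have "\<dots> = (real n - 1) * (2 / w * (y - x))" using n2 by (simp add: of_nat_diff)
  also have "\<dots> \<le> real n * (2 / w * (y - x))"
    using assms w_gt by (intro mult_right_mono) auto
  finally show "plateau y - plateau x \<le> real n * (2 / w) * (y - x)" by (simp add: mult.assoc)
qed

lemma plateau_abs_le: "\<bar>plateau x\<bar> \<le> real n"
proof -
  define s where "s = (\<Sum>l=1..<n. clamp01 (2 * x / w - (2 * real l - 1)))"
  define r where "r = (real n - 1) * clamp01 (2 * (x - 1) / d + 1)"
  have "s \<le> (\<Sum>l=1..<n. 1)" unfolding s_def by (intro sum_mono clamp01_bounds)
  then have "s \<le> real n - 1" using n2 by (simp add: of_nat_diff)
  moreover have "0 \<le> s" unfolding s_def by (intro sum_nonneg clamp01_bounds)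
  moreover have "r \<le> real n - 1"
    using mult_left_mono[OF clamp01_bounds(2), of "real n - 1"] n2 by (simp add: r_def)
  moreover have "0 \<le> r"
    unfolding r_def using n2 by (intro mult_nonneg_nonneg clamp01_bounds) auto
  ultimately have "\<bar>s - r\<bar> \<le> real n" by (simp add: abs_le_iff)
  then show ?thesis by (simp add: plateau_def s_def r_def)
qed

section \<open>Cut points and the profiles built on them\<close>

definition cutpoint :: "nat set \<Rightarrow> real" where
  "cutpoint S = real (card S) * w + e * real (set_encode S)"

definition full_cut :: real where "full_cut = cutpoint {1..<n}"

text \<open>The correction by \<open>e 2^j |S|\<close> at \<open>cutpoint S\<close> cancels the term \<open>e 2^j\<close> in
  \<open>cutpoint (insert j S) - cutpoint S = w + e 2^j\<close>.\<close>
definition F :: "nat \<Rightarrow> real \<Rightarrow> real" where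
  "F j x = x - e * 2 ^ j * plateau x"

text \<open>The slope is below 1 up to \<open>full_cut\<close>, so pieces there are longer than
  their value; the cake beyond \<open>full_cut\<close> is worth exactly \<open>w\<close>.\<close>

definition G :: "real \<Rightarrow> real" where
  "G x = (1 - w) / full_cut * min x full_cut + w / (1 - full_cut) * max 0 (x - full_cut)"

text \<open>Slope 1/2 is affordable because \<open>F j\<close> rises faster for
  \<open>j < n\<close>; half-width \<open>e/2\<close> suits cut points at least \<open>e\<close>
  apart.\<close>

definition tent :: "nat set \<Rightarrow> real \<Rightarrow> real" where
  "tent T x = max 0 (e / 2 - \<bar>x - cutpoint T\<bar>) / 2"

definition base :: "nat \<Rightarrow> real \<Rightarrow> real" where
  "base i = (if i = n then G else F i)"

definition bumped :: "nat \<Rightarrow> nat set \<Rightarrow> nat \<Rightarrow> real \<Rightarrow> real" where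
  "bumped j T i x = base i x + (if i = j then tent T x else 0)"

lemma encode_bounds:
  assumes "S \<subseteq> {1..<n}"
  shows "real (set_encode S) \<le> 2 ^ n" "S \<noteq> {} \<Longrightarrow> 1 \<le> real (set_encode S)"
proof -
  have fin: "finite S" using assms finite_subset by blast
  have "set_encode S \<le> (\<Sum>k<n. 2 ^ k)"
    unfolding set_encode_def using assms by (intro sum_mono2) auto
  also have "\<dots> \<le> 2 ^ n" using mask_eq_sum_exp_nat[of n] by (simp add: lessThan_def)
  finally show "real (set_encode S) \<le> 2 ^ n"
    using of_nat_le_iff[of "set_encode S" "2 ^ n", where 'a = real] by simp
  assume "S \<noteq> {}"
  then obtain s where "s \<in> S" by blast
  then have "(2::nat) ^ s \<le> set_encode S"
    unfolding set_encode_def using fin by (intro member_le_sum) auto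
  moreover have "(1::nat) \<le> 2 ^ s" by simp
  ultimately have "1 \<le> set_encode S" by linarith
  then show "1 \<le> real (set_encode S)" by simp
qed

lemma cutpoint_bounds:
  assumes "S \<subseteq> {1..<n}"
  shows "real (card S) * w \<le> cutpoint S" "cutpoint S \<le> real (card S) * w + e * 2 ^ n"
    "S \<noteq> {} \<Longrightarrow> real (card S) * w + e \<le> cutpoint S"
proof -
  show "real (card S) * w \<le> cutpoint S" using e0 by (simp add: cutpoint_def)
  have "e * real (set_encode S) \<le> e * 2 ^ n"
    using encode_bounds(1)[OF assms] e0 by (intro mult_left_mono) auto
  then show "cutpoint S \<le> real (card S) * w + e * 2 ^ n" by (simp add: cutpoint_def)
  assume "S \<noteq> {}"
  then have "e * 1 \<le> e * real (set_encode S)"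
    using encode_bounds(2)[OF assms] e0 by (intro mult_left_mono) auto
  then show "real (card S) * w + e \<le> cutpoint S" by (simp add: cutpoint_def)
qed

lemma cutpoint_insert:
  assumes "finite S" "j \<notin> S"
  shows "cutpoint (insert j S) = cutpoint S + w + e * 2 ^ j"
  using assms by (simp add: cutpoint_def algebra_simps)

lemma card_lt: "S \<subseteq> {1..<n} \<Longrightarrow> card S < n"
  using card_mono[of "{1..<n}" S] n2 by auto

section \<open>Distribution functions of the agents below \<open>n\<close>\<close>

text \<open>The plateau is constant near a cut point, so \<open>F\<close> is a translation there. A
  nonempty \<open>S\<close> has code at least 1, which leaves room \<open>e\<close> on the left; the
  cut point of the empty set is the left end of the cake.\<close>

lemma F_near_cutpoint:
  assumes "S \<subseteq> {1..<n}" "\<bar>t\<bar> \<le> e" "S = {} \<Longrightarrow> t = 0"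
  shows "F j (cutpoint S + t) = cutpoint S + t - e * 2 ^ j * real (card S)"
proof -
  have "plateau (cutpoint S + t) = real (card S)"
  proof (rule plateau_eq[OF card_lt[OF assms(1)]])
    show "real (card S) * w \<le> cutpoint S + t"
      using cutpoint_bounds[OF assms(1)] assms(2,3) by (cases "S = {}") auto
    show "cutpoint S + t \<le> real (card S) * w + d / 2"
      using cutpoint_bounds[OF assms(1)] assms(2) e_small d0 by linarith
  qed
  then show ?thesis by (simp add: F_def)
qed

lemma F_cutpoint_insert:
  assumes "S \<subseteq> {1..<n}" "j \<in> {1..<n} - S"
  shows "F j (cutpoint (insert j S)) = F j (cutpoint S) + w"
proof -
  have "finite S" using assms(1) finite_subset by blast
  then show ?thesis
    using F_near_cutpoint[of S 0 j] F_near_cutpoint[of "insert j S" 0 j] assms e0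
    by (simp add: cutpoint_insert algebra_simps)
qed

text \<open>The subtracted term rises with slope at most
  \<open>e 2^n n (2/w) \<le> z/(2 w) < 1/2\<close>. The remaining slope above 1/2 makes room for a
  tent.\<close>

lemma F_diff_gt:
  assumes "j < n" "x < y"
  shows "(y - x) / 2 < F j y - F j x"
proof -
  have j: "e * 2 ^ j \<le> e * 2 ^ n"
    using assms e0 by (intro mult_left_mono power_increasing) auto
  have "e * 2 ^ j * (plateau y - plateau x) \<le> e * 2 ^ j * (real n * (2 / w) * (y - x))"
    using plateau_diff_le[of x y] assms e0 by (intro mult_left_mono) auto
  also have "\<dots> \<le> e * 2 ^ n * (real n * (2 / w) * (y - x))"
    using j w_gt assms by (intro mult_right_mono) auto
  also have "\<dots> = (4 * (e * 2 ^ n * real n)) * ((y - x) / (2 * w))" by simp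
  also have "\<dots> \<le> z * ((y - x) / (2 * w))"
    using ez w_gt assms by (intro mult_right_mono) auto
  also have "\<dots> < w * ((y - x) / (2 * w))"
    using w_gt assms by (intro mult_strict_right_mono) auto
  also have "\<dots> = (y - x) / 2" using w_gt by simp
  finally show ?thesis by (simp add: F_def algebra_simps) argo
qed

text \<open>The plateau stays within \<open>n\<close> of 0, so value exceeds length by at most
  \<open>2 n e 2^n \<le> z\<close>. This crude bound serves the orders in which agent
  \<open>n\<close> is not last.\<close>

lemma F_piece_length:
  assumes "j < n" "x < y"
  shows "F j y - F j x - z \<le> y - x"
proof -
  have j: "e * 2 ^ j \<le> e * 2 ^ n"
    using assms e0 by (intro mult_left_mono power_increasing) auto
  have "e * 2 ^ j * (plateau x - plateau y) \<le> z"
  proof -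
    have "e * 2 ^ j * (plateau x - plateau y) \<le> e * 2 ^ j * (2 * real n)"
      using plateau_abs_le[of x] plateau_abs_le[of y] e0 by (intro mult_left_mono) auto
    also have "\<dots> \<le> e * 2 ^ n * (2 * real n)"
      using j by (intro mult_right_mono) auto
    also have "\<dots> \<le> z" using ez z0 by linarith
    finally show ?thesis .
  qed
  then show ?thesis by (simp add: F_def algebra_simps)
qed

lemma continuous_plateau: "continuous_on UNIV plateau"
  unfolding plateau_def[abs_def] clamp01_def by (intro continuous_intros) (use w_gt d0 in auto)

lemma cdf_F:
  assumes "j < n"
  shows "cdf (F j)"
  unfolding cdf_def
proof (intro conjI)
  show "strict_mono (F j)"
    using F_diff_gt[OF assms] by (intro strict_monoI) (smt (verit) divide_pos_pos)
  show "continuous_on UNIV (F j)"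
    unfolding F_def[abs_def] by (intro continuous_intros continuous_plateau)
  show "F j 0 = 0" using plateau_eq[of 0 0] n2 d0 by (simp add: F_def)
  show "F j 1 = 1" by (simp add: F_def plateau_1)
qed

lemma tent_diff_le: "x \<le> y \<Longrightarrow> tent T x - tent T y \<le> (y - x) / 2"
  by (auto simp: tent_def max_def abs_if)

lemma tent_eq_0: "e / 2 \<le> \<bar>x - cutpoint T\<bar> \<Longrightarrow> tent T x = 0"
  by (simp add: tent_def)

text \<open>The tent falls with slope at most 1/2, while \<open>F\<close> rises faster. Its peak,
  between \<open>w\<close> and \<open>1 - d + e 2^n\<close>, is too far from both ends of the cake
  to affect them.\<close>

lemma cdf_bumped_F:
  assumes j: "j < n" and T: "T \<subseteq> {1..<n}" "T \<noteq> {}"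
  shows "cdf (\<lambda>x. F j x + tent T x)"
  unfolding cdf_def
proof (intro conjI)
  show "strict_mono (\<lambda>x. F j x + tent T x)"
  proof (rule strict_monoI)
    fix x y :: real assume "x < y"
    then show "F j x + tent T x < F j y + tent T y"
      using F_diff_gt[OF j, of x y] tent_diff_le[of x y T] by linarith
  qed
  show "continuous_on UNIV (\<lambda>x. F j x + tent T x)"
    using cdf_F[OF j] unfolding cdf_def tent_def by (intro continuous_intros) auto
  have c1: "1 \<le> card T" using T finite_subset[OF T(1)] by (simp add: Suc_le_eq card_gt_0_iff)
  then have "1 * w \<le> real (card T) * w" using w_gt by (intro mult_right_mono) auto
  then have "e / 2 \<le> cutpoint T" using cutpoint_bounds(1)[OF T(1)] e_small w_gt e0 z0 by linarith
  then have "tent T 0 = 0" by (intro tent_eq_0) auto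
  then show "F j 0 + tent T 0 = 0" using cdf_F[OF j] by (simp add: cdf_def)
  have "real (card T) * w \<le> (real n - 1) * w"
    using card_lt[OF T(1)] w_gt by (intro mult_right_mono) auto
  then have "cutpoint T \<le> 1 - d + e * 2 ^ n" using cutpoint_bounds(2)[OF T(1)] by (simp add: d_def)
  then have "tent T 1 = 0" using e_small e0 d0 by (intro tent_eq_0) linarith
  then show "F j 1 + tent T 1 = 1" using cdf_F[OF j] by (simp add: cdf_def)
qed

section \<open>Distribution function of agent \<open>n\<close>\<close>

lemma full_cut_bounds: "1 - d \<le> full_cut" "full_cut < 1" "0 < full_cut" "1 - w < full_cut"
proof -
  have c: "real (card {1..<n}) = real n - 1" using n2 by (simp add: of_nat_diff)
  have "1 - d \<le> full_cut" "full_cut \<le> 1 - d + e * 2 ^ n"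
    using cutpoint_bounds[of "{1..<n}"] unfolding c full_cut_def by (auto simp: d_def)
  then show "1 - d \<le> full_cut" "full_cut < 1" "0 < full_cut" "1 - w < full_cut"
    using e_small e0 d0 d_less_w w_less_1 by linarith+
qed

lemma G_le_full_cut: "x \<le> full_cut \<Longrightarrow> G x = (1 - w) / full_cut * x"
  by (simp add: G_def)

lemma G_full_cut: "G full_cut = 1 - w"
  using full_cut_bounds by (simp add: G_def)

lemma cdf_G: "cdf G"
  unfolding cdf_def
proof (intro conjI)
  have a: "0 < (1 - w) / full_cut" "0 < w / (1 - full_cut)"
    using full_cut_bounds w_less_1 w_gt by auto
  show "strict_mono G"
  proof (rule strict_monoI)
    fix x y :: real assume xy: "x < y"
    show "G x < G y"
    proof (cases "x < full_cut")
      case True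
      then have "(1 - w) / full_cut * min x full_cut < (1 - w) / full_cut * min y full_cut"
        using a xy by (intro mult_strict_left_mono) auto
      moreover have "w / (1 - full_cut) * max 0 (x - full_cut) \<le> w / (1 - full_cut) * max 0 (y - full_cut)"
        using a xy by (intro mult_left_mono) auto
      ultimately show ?thesis by (simp add: G_def)
    next
      case False
      then have "w / (1 - full_cut) * max 0 (x - full_cut) < w / (1 - full_cut) * max 0 (y - full_cut)"
        using a xy by (intro mult_strict_left_mono) auto
      then show ?thesis using False xy by (simp add: G_def)
    qed
  qed
  show "continuous_on UNIV G"
    unfolding G_def[abs_def] by (intro continuous_intros)
  show "G 0 = 0" "G 1 = 1" using full_cut_bounds by (simp_all add: G_def)
qed

section \<open>The base profile and its bumped variants\<close>

lemma cdf_base: "i \<in> {1..n} \<Longrightarrow> cdf (base i)"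
  by (auto simp: base_def cdf_G cdf_F)

lemma cdf_bumped:
  assumes "j \<in> {1..<n}" "T \<subseteq> {1..<n}" "T \<noteq> {}" "i \<in> {1..n}"
  shows "cdf (bumped j T i)"
proof (cases "i = j")
  case True
  then show ?thesis
    using cdf_bumped_F[of j T] assms by (simp add: bumped_def[abs_def] base_def)
next
  case False
  then show ?thesis using cdf_base[OF assms(4)] by (simp add: bumped_def[abs_def])
qed

text \<open>If agent \<open>n\<close> is last, the others push it past \<open>full_cut\<close>,
  beyond which only \<open>w\<close> is left. If another agent lies to its right, there is not
  enough length.\<close>

lemma base_no_good_allocation: "\<not> exists_good_allocation n z (\<lambda>i. val (base i))"
proof
  assume good: "exists_good_allocation n z (\<lambda>i. val (base i))"
  have w': "0 \<le> 1 / real n + z" using w_gt by (simp add: w_def)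
  obtain a b where ab: "\<And>i. i \<in> {1..n} \<Longrightarrow> 0 \<le> a i \<and> a i < b i \<and> b i \<le> 1 \<and> base i (b i) - base i (a i) > w"
    and ord: "\<And>i j. i \<in> {1..n} \<Longrightarrow> j \<in> {1..n} \<Longrightarrow> i \<noteq> j \<Longrightarrow> b i \<le> a j \<or> b j \<le> a i"
    using allocation_endpoints[of n base z, OF cdf_base w' good] unfolding w_def by metis
  have nn: "n \<in> {1..n}" using n2 by simp
  have F_ab: "F i (b i) - F i (a i) > w" if "i \<in> {1..<n}" for i
    using ab[of i] that by (auto simp: base_def)
  have G_ab: "G (b n) - G (a n) > w"
    using ab[OF nn] by (simp add: base_def)
  have len: "w - z < b i - a i" if "i \<in> {1..<n}" for i
    using F_piece_length[of i "a i" "b i"] ab[of i] F_ab[OF that] that by auto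
  show False
  proof (cases "\<forall>i\<in>{1..<n}. b i \<le> a n")
    case True
    \<comment> \<open>The potential is \<open>cutpoint\<close>: agent \<open>m\<close> values the
      stretch from \<open>cutpoint S\<close> to \<open>cutpoint (insert m S)\<close> at exactly
      \<open>w\<close>, so a piece worth more that starts at or after the former ends after the
      latter.\<close>
    have "cutpoint {1..<n} \<le> a n"
    proof (rule chain_bound[where L = 0 and a = a and b = b])
      fix S m assume S: "S \<subseteq> {1..<n}" "m \<in> {1..<n} - S" "cutpoint S \<le> a m"
      have m: "cdf (F m)" using S by (intro cdf_F) auto
      have "F m (cutpoint (insert m S)) = F m (cutpoint S) + w" using S by (intro F_cutpoint_insert)
      also have "\<dots> \<le> F m (a m) + w" using S cdf_le[OF m] by simp
      also have "\<dots> \<le> F m (b m)" using F_ab[of m] S by auto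
      finally show "cutpoint (insert m S) \<le> b m" using cdf_le[OF m] by simp
    next
      show "0 \<le> a n" using ab[OF nn] by simp
      show "cutpoint {} \<le> 0" by (simp add: cutpoint_def)
      show "a i < b i \<and> 0 \<le> a i \<and> b i \<le> a n" if "i \<in> {1..<n}" for i
        using ab[of i] True that by auto
      show "b i \<le> a j \<or> b j \<le> a i" if "i \<in> {1..<n}" "j \<in> {1..<n}" "i \<noteq> j" for i j
        using ord[of i j] that by auto
    qed simp
    then have "G full_cut \<le> G (a n)" using cdf_le[OF cdf_G] by (simp add: full_cut_def)
    moreover have "G (b n) \<le> G 1" using cdf_le[OF cdf_G] ab[OF nn] by simp
    ultimately show False using G_ab G_full_cut cdf_G by (simp add: cdf_def)
  next
    case False
    then obtain i where i: "i \<in> {1..<n}" "\<not> b i \<le> a n" by blast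
    then have bn: "b n \<le> a i" using ord[of i n] by auto
    have nz: "2 * z \<le> real n * z" using n2 z0 by (intro mult_right_mono) auto
    show False
    proof (cases "b n \<le> full_cut")
      case True
      have "(1 - w) / full_cut * (b n - a n) > w"
        using G_ab ab[OF nn] True by (simp add: G_le_full_cut right_diff_distrib)
      moreover have "(1 - w) / full_cut * (b n - a n) \<le> 1 * (b n - a n)"
        using full_cut_bounds ab[OF nn] by (intro mult_right_mono) auto
      ultimately have len_n: "w < b n - a n" by simp
      \<comment> \<open>The potential is now the length already used. Agent \<open>n\<close> takes
        more than \<open>w\<close> and the others more than \<open>w - z\<close> each, in all more
        than \<open>n w - (n - 1) z = 1 + z\<close>.\<close>
      have "(\<Sum>i\<in>{1..n}. b i - a i) \<le> 1"
      proof (rule chain_bound[where L = 0 and a = a and b = b and \<phi> = "\<lambda>S. \<Sum>i\<in>S. b i - a i"])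
        fix S m assume "S \<subseteq> {1..n}" "m \<in> {1..n} - S" "(\<Sum>i\<in>S. b i - a i) \<le> a m"
        moreover from this have "finite S" using finite_subset by blast
        ultimately show "(\<Sum>i\<in>insert m S. b i - a i) \<le> b m" by simp
      qed (use ab ord in auto)
      moreover have "{1..n} = insert n {1..<n}" using n2 by auto
      ultimately have "(b n - a n) + (\<Sum>i\<in>{1..<n}. b i - a i) \<le> 1" by simp
      moreover have "(\<Sum>i\<in>{1..<n}. w - z) \<le> (\<Sum>i\<in>{1..<n}. b i - a i)"
        using len by (intro sum_mono less_imp_le)
      moreover have "(\<Sum>i\<in>{1..<n}. w - z) = real n * w - w - real n * z + z"
        using n2 by (simp add: of_nat_diff algebra_simps)
      ultimately show False using len_n nw z0 by linarith
    next
      case False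
      \<comment> \<open>Right of \<open>full_cut\<close> at most
        \<open>d = w - n z \<le> w - 2 z\<close> is left, but agent \<open>i\<close> needs more than
        \<open>w - z\<close>.\<close>
      have "b i - a i \<le> 1 - full_cut" using False bn ab[of i] i by auto
      also have "\<dots> \<le> d" using full_cut_bounds by simp
      also have "d \<le> w - 2 * z" using w_minus_d nz by linarith
      finally show False using len[OF i(1)] z0 by linarith
    qed
  qed
qed

text \<open>The agents are served in the order \<open>T - {j}\<close>, \<open>j\<close>, the rest,
  \<open>n\<close>; each cut before the last is within \<open>e/8\<close> of the cut point of the
  set served so far.\<close>

lemma bumped_good_allocation:
  assumes T: "T \<subseteq> {1..<n}" and j: "j \<in> T"
  shows "exists_good_allocation n z (\<lambda>i. val (bumped j T i))"
proof -
  define m where "m = card T"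
  \<comment> \<open>The drop at \<open>j\<close> costs less than \<open>n \<tau> = e/8\<close>,
    while the tent still has height \<open>3 e/16\<close> at distance \<open>e/8\<close> from its
    peak.\<close>
  define \<tau> where "\<tau> = e / (8 * real n)"
  have \<tau>: "0 < \<tau>" "8 * (real n * \<tau>) = e" using e0 n2 by (auto simp: \<tau>_def)
  define ys where "ys = sorted_list_of_set (T - {j}) @ [j] @ sorted_list_of_set ({1..<n} - T)"
  define xs where "xs = ys @ [n]"
  have fT: "finite T" using T finite_subset by blast
  have ys: "distinct ys" "set ys = {1..<n}"
    using T j fT by (auto simp: ys_def)
  then have xs: "distinct xs" "set xs = {1..n}"
    using n2 by (auto simp: xs_def)
  have len: "length ys = n - 1"
    using ys distinct_card[of ys] by simp
  define P where "P k = set (take k ys)" for k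
  have P_sub: "P k \<subseteq> {1..<n}" for k
    using ys set_take_subset[of k ys] by (simp add: P_def)
  have P_Suc: "P (Suc k) = insert (ys ! k) (P k)" "ys ! k \<notin> P k" if "k < n - 1" for k
  proof -
    show "P (Suc k) = insert (ys ! k) (P k)"
      using that len by (simp add: P_def take_Suc_conv_app_nth)
    have "distinct (take (Suc k) ys)" using ys by simp
    then show "ys ! k \<notin> P k"
      using that len by (simp add: P_def take_Suc_conv_app_nth)
  qed
  have P_card: "card (P k) = k" if "k \<le> n - 1" for k
    using that ys len distinct_card[of "take k ys"] by (simp add: P_def)
  have P_fin: "finite (P k)" for k by (simp add: P_def)
  have m1: "1 \<le> m" "m < n"
    using j fT card_lt[OF T] by (auto simp: m_def Suc_le_eq card_gt_0_iff)
  have m_len: "length (sorted_list_of_set (T - {j})) = m - 1"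
    using j fT by (simp add: m_def)
  \<comment> \<open>Positions count from 0: \<open>j\<close> follows the \<open>m - 1\<close> agents
    of \<open>T - {j}\<close>, so cut \<open>m\<close> is the one at the tent.\<close>
  have P_m: "P m = T" "ys ! (m - 1) = j"
    using m1 m_len j fT by (auto simp: P_def ys_def nth_append)
  have ys_j: "ys ! k = j \<longleftrightarrow> k = m - 1" if "k < n - 1" for k
    using that P_m(2) len m1 nth_eq_iff_index_eq[OF ys(1), of k "m - 1"] by simp
  \<comment> \<open>The cuts deviate from the cutpoints by \<open>t k\<close>, which grows by \<open>\<tau>\<close> at every step except that of \<open>j\<close>,
    where the tent pays for the drop from positive to negative deviations.\<close>
  define t where "t k = (if k < m then real k * \<tau> else - (real n - real k) * \<tau>)" for k
  define c where "c k = (if k = n then 1 else cutpoint (P k) + t k)" for k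
  have t_abs: "\<bar>t k\<bar> \<le> real n * \<tau>" if "k < n" for k
    using that \<tau> by (auto simp: t_def abs_mult)
  have t_e: "\<bar>t k\<bar> \<le> e" if "k < n" for k
    using t_abs[OF that] \<tau> e0 by linarith
  have t_0: "t 0 = 0" using m1 by (simp add: t_def)
  have F_c: "F i (c k) = cutpoint (P k) + t k - e * 2 ^ i * real k" if "k < n" for i k
  proof -
    have "P k = {} \<Longrightarrow> t k = 0" using P_card[of k] that t_0 by force
    then show ?thesis
      using F_near_cutpoint[OF P_sub[of k] t_e[OF that], of i] P_card[of k] that by (simp add: c_def)
  qed
  have piece: "bumped j T (xs ! k) (c (Suc k)) - bumped j T (xs ! k) (c k) > w" if k: "k < n" for k
  proof (cases "k = n - 1")
    case True
    have xk: "xs ! k = n" using True len by (simp add: xs_def nth_append)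
    have nj: "n \<noteq> j" using T j by auto
    have "P (n - 1) = {1..<n}" using len ys by (simp add: P_def)
    moreover have "\<not> n - 1 < m" "n - 1 \<noteq> n" using m1 by auto
    \<comment> \<open>Agent \<open>n\<close> starts \<open>\<tau>\<close> before
      \<open>full_cut\<close> and so gets more than the \<open>w\<close> beyond it.\<close>
    ultimately have "c k = full_cut - \<tau>"
      using True n2 by (simp add: c_def t_def full_cut_def of_nat_diff algebra_simps)
    moreover have "c (Suc k) = 1" using True n2 by (simp add: c_def)
    moreover have "G (full_cut - \<tau>) < G full_cut" using cdf_less[OF cdf_G] \<tau> by simp
    ultimately show ?thesis
      using cdf_G G_full_cut nj by (simp add: xk bumped_def base_def cdf_def)
  next
    case False
    then have kn: "k < n - 1" "Suc k < n" using k by auto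
    define i where "i = ys ! k"
    have xk: "xs ! k = i" using kn len by (simp add: xs_def nth_append i_def)
    have "i \<in> {1..<n}" using ys kn len unfolding i_def by (metis nth_mem)
    then have base: "base i = F i" by (auto simp: base_def)
    have "cutpoint (P (Suc k)) = cutpoint (P k) + w + e * 2 ^ i"
      using P_Suc[OF kn(1)] P_fin by (simp add: cutpoint_insert i_def)
    then have diff: "F i (c (Suc k)) - F i (c k) = w + t (Suc k) - t k"
      using F_c[OF k, of i] F_c[OF kn(2), of i] by (simp add: algebra_simps)
    show ?thesis
    proof (cases "Suc k = m")
      case True
      then have ij: "i = j" using P_m by (auto simp: i_def)
      have "t (Suc k) - t k = \<tau> - real n * \<tau>"
        using True by (simp add: t_def algebra_simps flip: True)
      moreover have "tent T (c (Suc k)) \<ge> (e / 2 - real n * \<tau>) / 2"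
      proof -
        have "c (Suc k) - cutpoint T = t (Suc k)" using True P_m kn by (simp add: c_def)
        then show ?thesis using t_abs[OF kn(2)] by (simp add: tent_def) argo
      qed
      moreover have "tent T (c k) = 0"
      proof (rule tent_eq_0)
        have "cutpoint T = cutpoint (P k) + w + e * 2 ^ i"
          using \<open>cutpoint (P (Suc k)) = _\<close> True P_m by simp
        moreover have "0 < e * 2 ^ i" using e0 by simp
        moreover have "c k = cutpoint (P k) + t k" using k by (simp add: c_def)
        moreover have "e \<le> w" using e_small w_gt e0 by linarith
        ultimately show "e / 2 \<le> \<bar>c k - cutpoint T\<bar>"
          using t_abs[OF k] \<tau>(2) e0 by linarith
      qed
      ultimately show ?thesis
        using diff \<tau> e0 base unfolding xk bumped_def ij by simp
    next
      case F: False
      then have "i \<noteq> j" using ys_j[OF kn(1)] m1 by (auto simp: i_def)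
      \<comment> \<open>Either both cuts precede cut \<open>m\<close> or neither does, so one branch
        of \<open>t\<close> covers both.\<close>
      moreover have "t (Suc k) - t k = \<tau>"
        using F by (simp add: t_def algebra_simps)
      ultimately show ?thesis using diff \<tau> by (simp add: xk bumped_def base)
    qed
  qed
  have cdf: "cdf (bumped j T (xs ! k))" if "k < n" for k
  proof (rule cdf_bumped)
    have "length xs = n" using len n2 by (simp add: xs_def)
    then show "xs ! k \<in> {1..n}" using xs that nth_mem by metis
  qed (use T j in auto)
  have inc: "c k < c (Suc k)" if "k < n" for k
    using piece[OF that] w_gt cdf_less[OF cdf[OF that], of "c k" "c (Suc k)"] by linarith
  show ?thesis
  proof (rule good_allocation_from_cuts[OF xs])
    show "c 0 = 0" using n2 t_0 by (simp add: c_def P_def cutpoint_def)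
    show "c n = 1" by (simp add: c_def)
    show "c k < c (Suc k)" if "k < n" for k by (rule inc[OF that])
    show "val (bumped j T (xs ! k)) {c k..c (Suc k)} > 1 / real n + z" if "k < n" for k
      using piece[OF that] val_Icc[OF cdf[OF that] less_imp_le[OF inc[OF that]]] by (simp add: w_def)
  qed
qed

section \<open>Counting the tents that a run detects\<close>

text \<open>Cut points of sets of different size are at least \<open>w - e 2^n \<ge> e\<close>
  apart; for equal size they differ by \<open>e\<close> times the difference of the integer
  codes.\<close>

lemma cutpoint_separated:
  assumes "S \<subseteq> {1..<n}" "T \<subseteq> {1..<n}" "\<bar>cutpoint S - cutpoint T\<bar> < e"
  shows "S = T"
proof -
  have le: "card T \<le> card S" if S: "S \<subseteq> {1..<n}" and T: "T \<subseteq> {1..<n}"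
    and lt: "\<bar>cutpoint S - cutpoint T\<bar> < e" for S T
  proof (rule ccontr)
    assume "\<not> ?thesis"
    then have "(real (card S) + 1) * w \<le> real (card T) * w"
      using w_gt by (intro mult_right_mono) auto
    then show False
      using cutpoint_bounds[OF S] cutpoint_bounds[OF T] lt e_small w_gt e0 by (simp add: algebra_simps)
  qed
  have "card S = card T"
    using le[OF assms] le[OF assms(2,1)] assms(3) by (simp add: abs_minus_commute)
  then have "\<bar>e * (real (set_encode S) - real (set_encode T))\<bar> < e * 1"
    using assms(3) by (simp add: cutpoint_def algebra_simps)
  then have "\<bar>real (set_encode S) - real (set_encode T)\<bar> < 1"
    using e0 by (simp add: abs_mult)
  then have "set_encode S = set_encode T" by linarith
  then show ?thesis using assms finite_subset set_encode_eq by (metis finite_atLeastLessThan)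
qed

text \<open>The run on the base profile must touch every tent, or else the same run with answer
  \<open>False\<close> occurs on a bumped profile, where \<open>True\<close> is correct. A touched
  pair lies in at most one tent of its agent.\<close>

lemma query_lower_bound:
  assumes A: "decides_good_allocation n z A"
  shows "\<exists>V b k. hungry_profile n V \<and> halts A V b k \<and> (n - 1) * 2 ^ (n - 2) \<le> 2 * k"
proof -
  let ?V = "\<lambda>i. val (base i)"
  have V: "hungry_profile n ?V"
    unfolding hungry_profile_def using cdf_base valuation_val hungry_val by blast
  obtain k where "halts A ?V False k"
    using A V base_no_good_allocation unfolding decides_good_allocation_def by metis
  then obtain h where h: "reaches A ?V h" "A h = Answer False" "length h = k"
    unfolding halts_def by blast
  obtain U where U: "finite U" "card U \<le> 2 * length h"
    "\<And>m q. m < length h \<Longrightarrow> A (take m h) = Ask q \<Longrightarrow> touched ?V q \<subseteq> U"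
    using card_touched_history[OF h(1)] by blast
  \<comment> \<open>The index \<open>(j, S)\<close> stands for the tent of \<open>j\<close> at
    \<open>cutpoint (insert j S)\<close>; \<open>S\<close> avoids \<open>j\<close> to make this
    injective.\<close>
  define I where "I = (SIGMA j:{1..<n}. Pow ({1..<n} - {j}))"
  have hit: "\<exists>x. (fst p, x) \<in> U \<and> \<bar>x - cutpoint (insert (fst p) (snd p))\<bar> < e / 2" if "p \<in> I" for p
  proof (rule ccontr)
    assume no: "\<not> ?thesis"
    obtain j S where p: "p = (j, S)" by force
    define T where "T = insert j S"
    have j: "j \<in> {1..<n}" and T: "T \<subseteq> {1..<n}" "j \<in> T"
      using that by (auto simp: p I_def T_def)
    let ?W = "\<lambda>i. val (bumped j T i)"
    have cdf_W: "cdf (bumped j T i)" if "i \<in> {1..n}" for i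
      using cdf_bumped[OF j T(1) _ that] T(2) by blast
    have W: "hungry_profile n ?W"
      unfolding hungry_profile_def using cdf_W valuation_val hungry_val by blast
    have "reaches A ?W h"
    proof (rule reaches_transfer[OF h(1)])
      fix m q assume mq: "m < length h" "A (take m h) = Ask q"
      have "reaches A ?V (take m h)" using reaches_prefix[OF h(1) mq(1)] by blast
      then have "legal_query n q"
        using A V mq(2) unfolding decides_good_allocation_def by blast
      moreover have "bumped j T i x = base i x" if "(i, x) \<in> touched ?V q" for i x
      proof (cases "i = j")
        case True
        then have "(j, x) \<in> U" using U(3)[OF mq] that by blast
        then have "e / 2 \<le> \<bar>x - cutpoint T\<bar>" using no by (auto simp: p T_def not_less)
        then show ?thesis by (simp add: bumped_def tent_eq_0)
      qed (simp add: bumped_def)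
      ultimately show "reply ?W q = reply ?V q"
        using cdf_base cdf_W by (intro reply_eq_if_untouched) auto
    qed
    moreover obtain k' where "halts A ?W True k'"
      using A W bumped_good_allocation[OF T] unfolding decides_good_allocation_def by metis
    then obtain h' where "reaches A ?W h'" "A h' = Answer True"
      unfolding halts_def by blast
    ultimately show False using answer_unique h(2) by blast
  qed
  then obtain g where g: "\<And>p. p \<in> I \<Longrightarrow> (fst p, g p) \<in> U \<and> \<bar>g p - cutpoint (insert (fst p) (snd p))\<bar> < e / 2"
    by metis
  \<comment> \<open>A point inside two tents of one agent puts their peaks less than
    \<open>e\<close> apart.\<close>
  have "inj_on (\<lambda>p. (fst p, g p)) I"
  proof (rule inj_onI)
    fix p q assume pq: "p \<in> I" "q \<in> I" "(fst p, g p) = (fst q, g q)"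
    obtain j S T where p: "p = (j, S)" "q = (j, T)" using pq(3) by (cases p, cases q) auto
    have sub: "S \<subseteq> {1..<n} - {j}" "T \<subseteq> {1..<n} - {j}" "j \<in> {1..<n}"
      using pq by (auto simp: p I_def)
    have "\<bar>cutpoint (insert j S) - cutpoint (insert j T)\<bar> < e"
      using g[OF pq(1)] g[OF pq(2)] pq(3) unfolding p fst_conv snd_conv prod.inject
      by linarith
    then have "insert j S = insert j T" using sub by (intro cutpoint_separated) auto
    then show "p = q" using sub p by blast
  qed
  then have "card I \<le> card U"
    using U(1) g by (intro card_inj_on_le) auto
  moreover have "card I = (n - 1) * 2 ^ (n - 2)"
  proof -
    have "card I = (\<Sum>j\<in>{1..<n}. card (Pow ({1..<n} - {j})))"
      unfolding I_def by (intro card_SigmaI) auto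
    also have "\<dots> = (\<Sum>j\<in>{1..<n}. 2 ^ (n - 2))"
      by (intro sum.cong refl) (simp add: card_Pow numeral_2_eq_2)
    finally show ?thesis by simp
  qed
  ultimately have "(n - 1) * 2 ^ (n - 2) \<le> 2 * k" using U(2) h(3) by simp
  then show ?thesis using V h unfolding halts_def by blast
qed

end

theorem theorem12:
  shows "\<exists>c::real. c > 0 \<and>
    (\<forall>n::nat. n \<ge> 2 \<longrightarrow>
      (\<forall>z::real. 0 < z \<and> z < 1 / (real n * (real n - 1)) \<longrightarrow>
        (\<forall>A. decides_good_allocation n z A \<longrightarrow>
          (\<exists>V b k. hungry_profile n V \<and> halts A V b k \<and> real k \<ge> c * (real n * 2 ^ n)))))"
proof (intro exI[of _ "1 / 16"] conjI allI impI)
  fix n :: nat and z :: real and A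
  assume n: "2 \<le> n" and z: "0 < z \<and> z < 1 / (real n * (real n - 1))"
    and A: "decides_good_allocation n z A"
  define w where "w = 1 / real n + z"
  define d where "d = 1 - (real n - 1) * w"
  define e where "e = min z d / (4 * (2 ^ n * real n))"
  \<comment> \<open>\<open>(n - 1) w < 1\<close> amounts to \<open>(n - 1) z < 1/n\<close>; the
    upper bound on \<open>z\<close> enters here.\<close>
  have "(real n - 1) * z < (real n - 1) * (1 / (real n * (real n - 1)))"
    using z n by (intro mult_strict_left_mono) auto
  also have "\<dots> = 1 / real n" using n by simp
  finally have "0 < d" using n by (simp add: d_def w_def field_simps)
  then have "0 < min z d" using z by simp
  moreover have "4 * (e * 2 ^ n * real n) = min z d" using n by (simp add: e_def field_simps)
  ultimately have "hard_instance n z w d e"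
    using n z \<open>0 < d\<close> unfolding hard_instance_def by (simp add: w_def d_def e_def)
  from hard_instance.query_lower_bound[OF this A]
  obtain V b k where V: "hungry_profile n V" "halts A V b k" "(n - 1) * 2 ^ (n - 2) \<le> 2 * k"
    by blast
  \<comment> \<open>The constant 16 is the product of 4 from \<open>2^n = 4 * 2^(n-2)\<close>, 2
    from \<open>n \<le> 2 (n - 1)\<close> and 2 points per query.\<close>
  have "n * 2 ^ n = n * (4 * 2 ^ (n - 2))"
    using n by (simp add: power_eq_if numeral_2_eq_2)
  also have "\<dots> \<le> (2 * (n - 1)) * (4 * 2 ^ (n - 2))"
    using n by (intro mult_right_mono) auto
  also have "\<dots> \<le> 16 * k" using V(3) by simp
  finally have "real (n * 2 ^ n) \<le> real (16 * k)" by (rule of_nat_mono)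
  then show "\<exists>V b k. hungry_profile n V \<and> halts A V b k \<and> real k \<ge> 1 / 16 * (real n * 2 ^ n)"
    using V by (intro exI[of _ V] exI[of _ b] exI[of _ k]) simp
qed simp

end
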